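(* Let $G$ be a fixed graph of degeneracy $d \ge 2$, and let $\omega=\omega(n)$ be any function with $\omega(n)\to\infty$ as $n\to\infty$. Set $t = n^{(d-1)/d}/\omega$. Then for any strategy $\mathcal{S}$ of the player in the semi-random graph process, $$\lim_{n\to\infty}\mathbb{P}\big[H_t \text{ contains a subgraph isomorphic to } G\big]=0,$$ where $H_t=H_t^{\mathcal S}(n)$.
   Context: The semi-random graph process on vertex set $[n]=\{1,\dots,n\}$: it starts with the empty graph $H_0$ on $[n]$. In each step $t\ge 1$ a vertex $u_t$ is chosen uniformly at random from $[n]$ (independently of the past); the player, knowing $H_{t-1}$ and $u_t$, selects a vertex $v_t$ and the edge $u_tv_t$ is added to $H_{t-1}$ to form $H_t$ (loops and parallel edges are allowed). A strategy $\mathcal S$ specifies, for each $n$ and each $t$, a probability distribution on $[n]$ depending on $u_1,v_1,\dots,u_{t-1},v_{t-1},u_t$, from which $v_t$ is drawn; $H_t^{\mathcal S}(n)$ denotes the resulting (multi)graph after $t$ steps. A graph $G$ is $d$-degenerate if every subgraph $G'\subseteq G$ has minimum degree at most $d$; the degeneracy of $G$ is the smallest $d$ for which $G$ is $d$-degenerate. *)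

theory Defs
  imports "HOL-Probability.Probability" "HOL-Library.Multiset"
begin

text \<open>Undirected graphs, possibly with loops and parallel edges: an edge joining \<open>x\<close> and \<open>y\<close> is
  the set \<open>{x, y}\<close>, hence a singleton for a loop, and parallel edges are repeated elements of
  the multiset.\<close>

record 'a mgraph =
  verts :: "'a set"
  edges :: "'a set multiset"

definition wf_mgraph :: "'a mgraph \<Rightarrow> bool" where
  "wf_mgraph H \<longleftrightarrow> (\<forall>e\<in>#edges H. e \<subseteq> verts H \<and> (card e = 1 \<or> card e = 2))"

definition finite_simple_graph :: "'a mgraph \<Rightarrow> bool" where
  "finite_simple_graph G \<longleftrightarrow> wf_mgraph G \<and> finite (verts G) \<and>
     (\<forall>e\<in>#edges G. card e = 2) \<and> (\<forall>e. count (edges G) e \<le> 1)"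

text \<open>A loop contributes two to the degree of its vertex.\<close>

definition degree :: "'a mgraph \<Rightarrow> 'a \<Rightarrow> nat" where
  "degree H x = size {#e \<in># edges H. x \<in> e#} + count (edges H) {x}"

definition min_degree :: "'a mgraph \<Rightarrow> nat" where
  "min_degree H = Min (degree H ` verts H)"

definition subgraph :: "'a mgraph \<Rightarrow> 'a mgraph \<Rightarrow> bool" where
  "subgraph K H \<longleftrightarrow> wf_mgraph K \<and> verts K \<subseteq> verts H \<and> edges K \<subseteq># edges H"

definition isomorphic :: "'a mgraph \<Rightarrow> 'b mgraph \<Rightarrow> bool" where
  "isomorphic G H \<longleftrightarrow>
     (\<exists>f. bij_betw f (verts G) (verts H) \<and> edges H = image_mset (\<lambda>e. f ` e) (edges G))"

definition contains_copy :: "'b mgraph \<Rightarrow> 'a mgraph \<Rightarrow> bool" where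
  "contains_copy H G \<longleftrightarrow> (\<exists>K. subgraph K H \<and> isomorphic K G)"

text \<open>The null graph has no minimum degree and is excluded.\<close>

definition degenerate :: "nat \<Rightarrow> 'a mgraph \<Rightarrow> bool" where
  "degenerate d G \<longleftrightarrow> (\<forall>K. subgraph K G \<and> verts K \<noteq> {} \<longrightarrow> min_degree K \<le> d)"

definition degeneracy :: "'a mgraph \<Rightarrow> nat" where
  "degeneracy G = (LEAST d. degenerate d G)"

lemma degenerate_degeneracy:
  assumes "finite_simple_graph G"
  shows "degenerate (degeneracy G) G"
proof -
  have "degenerate (2 * size (edges G)) G"
    unfolding degenerate_def
  proof (intro allI impI)
    fix K :: "'a mgraph"
    assume K: "subgraph K G \<and> verts K \<noteq> {}"
    then obtain x where x: "x \<in> verts K" by blast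
    have "finite (verts K)"
      using K assms by (auto simp: subgraph_def finite_simple_graph_def intro: finite_subset)
    then have "min_degree K \<le> degree K x"
      using x by (simp add: min_degree_def)
    also have "\<dots> \<le> size (edges K) + size (edges K)"
      unfolding degree_def
      by (intro add_mono size_filter_mset_lesseq) (rule count_le_size)
    also have "\<dots> \<le> 2 * size (edges G)"
      using K size_mset_mono[of "edges K" "edges G"] by (simp add: subgraph_def)
    finally show "min_degree K \<le> 2 * size (edges G)" .
  qed
  then show ?thesis
    unfolding degeneracy_def by (rule LeastI)
qed

text \<open>The process on \<open>{1..n}\<close>. A history \<open>h = [(u\<^sub>1, v\<^sub>1), \<dots>, (u\<^sub>t, v\<^sub>t)]\<close> lists the moves made so
  far, and \<open>S n h u\<close> is the distribution from which the player draws the other endpoint when the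
  vertex \<open>u\<close> is offered after \<open>h\<close>. The number of the current step is \<open>length h + 1\<close>, so it needs
  no argument of its own.\<close>

type_synonym history = "(nat \<times> nat) list"
type_synonym strategy = "nat \<Rightarrow> history \<Rightarrow> nat \<Rightarrow> nat pmf"

definition valid_strategy :: "strategy \<Rightarrow> bool" where
  "valid_strategy S \<longleftrightarrow>
     (\<forall>n h u. set h \<subseteq> {1..n} \<times> {1..n} \<and> u \<in> {1..n} \<longrightarrow> set_pmf (S n h u) \<subseteq> {1..n})"

text \<open>The law of the history after \<open>t\<close> steps. It is unspecified for \<open>n = 0\<close> and \<open>t > 0\<close>, where
  there is no vertex to choose.\<close>

primrec semi_random_process :: "strategy \<Rightarrow> nat \<Rightarrow> nat \<Rightarrow> history pmf" where
  "semi_random_process S n 0 = return_pmf []"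
| "semi_random_process S n (Suc t) =
     do {
       h \<leftarrow> semi_random_process S n t;
       u \<leftarrow> pmf_of_set {1..n};
       v \<leftarrow> S n h u;
       return_pmf (h @ [(u, v)])
     }"

definition history_graph :: "nat \<Rightarrow> history \<Rightarrow> nat mgraph" where
  "history_graph n h = \<lparr>verts = {1..n}, edges = mset (map (\<lambda>(u, v). {u, v}) h)\<rparr>"

text \<open>The random multigraph after \<open>t\<close> steps.\<close>

definition semi_random_graph :: "strategy \<Rightarrow> nat \<Rightarrow> nat \<Rightarrow> nat mgraph pmf" where
  "semi_random_graph S n t = map_pmf (history_graph n) (semi_random_process S n t)"

end

theory Submission
  imports Defs
begin

text \<open>Direct the edge of each step from the random vertex to the vertex chosen by the player. Give a
  step at \<open>u\<close> rank one more than the largest rank of an earlier step whose random vertex reaches \<open>u\<close>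
  along a short directed path (rank 1 if there is none). The out-degrees are bounded, so each step of
  rank at least \<open>r\<close> makes only \<open>O(1)\<close> vertices available for a step of rank \<open>r + 1\<close>: whatever the
  player does, the expected number of steps of rank at least \<open>r\<close> is \<open>O(t\<^sup>r / n\<^sup>r\<^sup>-\<^sup>1)\<close>, which tends to 0 for
  \<open>r = d\<close>. On the other hand, a subgraph of minimum degree at least \<open>d\<close> contains a step of rank \<open>d\<close>.
  Indeed, if no step of rank more than \<open>r\<close> reaches \<open>u\<close>, then some ancestor of \<open>u\<close> has degree at
  most \<open>r\<close>: before the last step at an ancestor of \<open>u\<close>, some ancestor of the vertex of that step has
  degree at most \<open>r - 1\<close> by induction, and only that step can raise its degree, by one.\<close>

section \<open>Ranks of steps and the effect of appending a step\<close>

text \<open>The indices of the steps of rank at least \<open>r + 1\<close>, where \<open>D h x\<close> is the set of vertices regarded as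
  reachable from \<open>x\<close> after the history \<open>h\<close>.\<close>

primrec ranked :: "(('v \<times> 'v) list \<Rightarrow> 'v \<Rightarrow> 'v set) \<Rightarrow> nat \<Rightarrow> ('v \<times> 'v) list \<Rightarrow> nat set" where
  "ranked D 0 h = {..<length h}"
| "ranked D (Suc r) h =
     {i. i < length h \<and> (\<exists>j\<in>ranked D r h. j < i \<and> fst (h ! i) \<in> D (take i h) (fst (h ! j)))}"

lemma ranked_subset: "ranked D r h \<subseteq> {..<length h}"
  by (cases r) auto

lemma finite_ranked: "finite (ranked D r h)"
  using finite_subset[OF ranked_subset] by blast

text \<open>The rank of a step is determined by the history up to that step, so later steps never
  change it.\<close>

lemma ranked_append_old:
  "i < length h \<Longrightarrow> i \<in> ranked D r (h @ [p]) \<longleftrightarrow> i \<in> ranked D r h"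
proof (induction r arbitrary: i)
  case (Suc r)
  then show ?case
    by (auto simp: nth_append)
qed simp

text \<open>Only the offered vertex \<open>fst p\<close> decides whether the new step counts; the
  player's reply \<open>snd p\<close> cannot influence the rank of its own step.\<close>

lemma ranked_Suc_append:
  "ranked D (Suc r) (h @ [p]) \<subseteq> ranked D (Suc r) h \<union>
     (if fst p \<in> (\<Union>j\<in>ranked D r h. D h (fst (h ! j))) then {length h} else {})"
proof
  fix i assume i: "i \<in> ranked D (Suc r) (h @ [p])"
  show "i \<in> ranked D (Suc r) h \<union>
     (if fst p \<in> (\<Union>j\<in>ranked D r h. D h (fst (h ! j))) then {length h} else {})"
  proof (cases "i < length h")
    case True
    then show ?thesis
      using i ranked_append_old[of i h D "Suc r" p] by blast
  next
    case False
    with i have [simp]: "i = length h" by simp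
    from i obtain j where j: "j \<in> ranked D r (h @ [p])" "j < length h"
      "fst p \<in> D h (fst (h ! j))"
      by (auto simp: nth_append)
    then have "j \<in> ranked D r h" by (simp add: ranked_append_old)
    with j show ?thesis by auto
  qed
qed

lemma card_ranked_Suc_append:
  "card (ranked D (Suc r) (h @ [p])) \<le> card (ranked D (Suc r) h) +
     (if fst p \<in> (\<Union>j\<in>ranked D r h. D h (fst (h ! j))) then 1 else 0)"
proof -
  have "card (ranked D (Suc r) (h @ [p])) \<le> card (ranked D (Suc r) h \<union>
     (if fst p \<in> (\<Union>j\<in>ranked D r h. D h (fst (h ! j))) then {length h} else {}))"
    using ranked_Suc_append[of D r h p] finite_ranked[of D "Suc r" h]
    by (intro card_mono) (auto simp del: ranked.simps)
  also have "\<dots> \<le> card (ranked D (Suc r) h) +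
     card (if fst p \<in> (\<Union>j\<in>ranked D r h. D h (fst (h ! j))) then {length h} else {})"
    by (rule card_Un_le)
  finally show ?thesis by (auto simp del: ranked.simps split: if_splits)
qed

section \<open>First-moment bound for the number of steps of given rank\<close>

lemma length_semi_random_process:
  "h \<in> set_pmf (semi_random_process S n t) \<Longrightarrow> length h = t"
  by (induction t arbitrary: h) auto

lemma nn_integral_semi_random_process_Suc:
  "(\<integral>\<^sup>+h. f h \<partial>semi_random_process S n (Suc t)) =
   (\<integral>\<^sup>+h. \<integral>\<^sup>+u. \<integral>\<^sup>+v. f (h @ [(u, v)]) \<partial>S n h u \<partial>pmf_of_set {1..n} \<partial>semi_random_process S n t)"
  by simp

text \<open>Given the history, each step in \<open>ranked D r h\<close> opens at most
  \<open>M\<close> vertices to the next offer, so it contributes probability at most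
  \<open>M / n\<close>. Hence in one time step the expectation for \<open>Suc r\<close> grows by at
  most \<open>M / n\<close> times the expectation for \<open>r\<close>; the bound follows by
  induction on \<open>r\<close> and, inside it, on \<open>t\<close>.\<close>

lemma expectation_card_ranked:
  fixes D :: "history \<Rightarrow> nat \<Rightarrow> nat set"
  assumes n: "n > 0"
    and fin: "\<And>h x. finite (D h x)" and card: "\<And>h x. card (D h x) \<le> M"
  shows "(\<integral>\<^sup>+h. of_nat (card (ranked D r h)) \<partial>semi_random_process S n t)
           \<le> ennreal (real t * (real t * real M / real n) ^ r)"
proof (induction r arbitrary: t)
  case 0
  have "(\<integral>\<^sup>+h. of_nat (card (ranked D 0 h)) \<partial>semi_random_process S n t) =
        (\<integral>\<^sup>+h. of_nat t \<partial>semi_random_process S n t)"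
    by (intro nn_integral_cong_AE) (auto simp: AE_measure_pmf_iff length_semi_random_process)
  then show ?case by (simp add: ennreal_of_nat_eq_real_of_nat)
next
  case (Suc r)
  note IH = Suc.IH
  let ?c = "\<lambda>r t. \<integral>\<^sup>+h. of_nat (card (ranked D r h)) \<partial>semi_random_process S n t"
  show ?case
  proof (induction t)
    case (Suc t)
    let ?q = "real t * (real t * real M / real n) ^ r * (real M / real n)"
    have step: "(\<integral>\<^sup>+u. \<integral>\<^sup>+v. of_nat (card (ranked D (Suc r) (h @ [(u, v)]))) \<partial>S n h u
                    \<partial>pmf_of_set {1..n})
          \<le> of_nat (card (ranked D (Suc r) h)) +
            of_nat (card (ranked D r h)) * ennreal (real M / real n)" for h
    proof -
      let ?B = "\<Union>j\<in>ranked D r h. D h (fst (h ! j))"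
      have finB: "finite ?B" using fin finite_ranked by blast
      have cardB: "card ?B \<le> card (ranked D r h) * M"
      proof -
        have "card ?B \<le> (\<Sum>j\<in>ranked D r h. card (D h (fst (h ! j))))"
          by (rule card_UN_le[OF finite_ranked])
        also have "\<dots> \<le> (\<Sum>j\<in>ranked D r h. M)" by (intro sum_mono card)
        finally show ?thesis by simp
      qed
      have "(\<integral>\<^sup>+u. \<integral>\<^sup>+v. of_nat (card (ranked D (Suc r) (h @ [(u, v)]))) \<partial>S n h u
                    \<partial>pmf_of_set {1..n})
        \<le> (\<integral>\<^sup>+u. \<integral>\<^sup>+v. (of_nat (card (ranked D (Suc r) h)) + indicator ?B u) \<partial>S n h u
                    \<partial>pmf_of_set {1..n})"
      proof (intro nn_integral_mono)
        fix u v
        have "card (ranked D (Suc r) (h @ [(u, v)])) \<le>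
              card (ranked D (Suc r) h) + (if u \<in> ?B then 1 else 0)"
          using card_ranked_Suc_append[of D r h "(u, v)"] by (simp del: ranked.simps)
        then have "(of_nat (card (ranked D (Suc r) (h @ [(u, v)]))) :: ennreal) \<le>
              of_nat (card (ranked D (Suc r) h) + (if u \<in> ?B then 1 else 0))"
          by (simp only: of_nat_le_iff)
        also have "\<dots> = of_nat (card (ranked D (Suc r) h)) + indicator ?B u"
          by (simp add: indicator_def del: ranked.simps)
        finally show "(of_nat (card (ranked D (Suc r) (h @ [(u, v)]))) :: ennreal) \<le>
              of_nat (card (ranked D (Suc r) h)) + indicator ?B u" .
      qed
      \<comment> \<open>The integrand is now free of \<open>v\<close>, so the integral over the
        player's distribution disappears and the strategy drops out.\<close>
      also have "\<dots> = of_nat (card (ranked D (Suc r) h)) + emeasure (pmf_of_set {1..n}) ?B"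
        by (simp add: nn_integral_add del: ranked.simps)
      also have "emeasure (pmf_of_set {1..n}) ?B \<le>
                   of_nat (card (ranked D r h)) * ennreal (real M / real n)"
      proof -
        have "measure_pmf.prob (pmf_of_set {1..n}) ?B = real (card ({1..n} \<inter> ?B)) / real n"
          using n by (subst measure_pmf_of_set) auto
        also have "\<dots> \<le> real (card ?B) / real n"
          using finB by (intro divide_right_mono) (auto intro!: card_mono)
        also have "\<dots> \<le> real (card (ranked D r h) * M) / real n"
          using cardB by (intro divide_right_mono) (simp_all only: of_nat_le_iff of_nat_0_le_iff)
        finally have "measure_pmf.prob (pmf_of_set {1..n}) ?B \<le>
            real (card (ranked D r h)) * (real M / real n)" by simp
        then show ?thesis
          by (simp add: measure_pmf.emeasure_eq_measure ennreal_of_nat_eq_real_of_nat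
              ennreal_mult[symmetric] ennreal_leI del: UN_simps)
      qed
      finally show ?thesis by (simp del: ranked.simps)
    qed
    have "?c (Suc r) (Suc t) \<le> (\<integral>\<^sup>+h. of_nat (card (ranked D (Suc r) h)) +
            of_nat (card (ranked D r h)) * ennreal (real M / real n) \<partial>semi_random_process S n t)"
      unfolding nn_integral_semi_random_process_Suc
      by (intro nn_integral_mono step)
    also have "\<dots> = ?c (Suc r) t + ?c r t * ennreal (real M / real n)"
      by (simp add: nn_integral_add nn_integral_multc del: ranked.simps)
    also have "\<dots> \<le> ennreal (real t * (real t * real M / real n) ^ Suc r) +
        ennreal (real t * (real t * real M / real n) ^ r) * ennreal (real M / real n)"
      by (intro add_mono mult_right_mono Suc.IH IH) simp
    also have "\<dots> = ennreal (real t * (real t * real M / real n) ^ Suc r + ?q)"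
      by (simp add: ennreal_mult[symmetric] ennreal_plus[symmetric] del: ennreal_plus)
    also have "\<dots> \<le> ennreal (real (Suc t) * (real (Suc t) * real M / real n) ^ Suc r)"
    proof (rule ennreal_leI)
      \<comment> \<open>With \<open>a = t * M / n\<close>, the increment \<open>?q\<close> is
        exactly \<open>a ^ Suc r\<close>.\<close>
      have "real t * (real t * real M / real n) ^ Suc r + ?q =
          (real t + 1) * (real t * real M / real n) ^ Suc r"
        by (simp add: algebra_simps add_divide_distrib)
      also have "\<dots> \<le> (real t + 1) * (real (Suc t) * real M / real n) ^ Suc r"
        by (intro mult_left_mono power_mono divide_right_mono mult_right_mono) auto
      finally show "real t * (real t * real M / real n) ^ Suc r + ?q \<le>
          real (Suc t) * (real (Suc t) * real M / real n) ^ Suc r"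
        by (simp only: of_nat_Suc add.commute)
    qed
    finally show ?case .
  qed simp
qed

text \<open>Markov's inequality: a nonempty set of steps has cardinality at least 1.\<close>

lemma prob_ranked_nonempty:
  fixes D :: "history \<Rightarrow> nat \<Rightarrow> nat set"
  assumes "n > 0"
    and "\<And>h x. finite (D h x)" and "\<And>h x. card (D h x) \<le> M"
  shows "measure_pmf.prob (semi_random_process S n t) {h. ranked D r h \<noteq> {}}
           \<le> real t * (real t * real M / real n) ^ r"
proof -
  let ?P = "semi_random_process S n t"
  have "emeasure ?P {h. ranked D r h \<noteq> {}} = (\<integral>\<^sup>+h. indicator {h. ranked D r h \<noteq> {}} h \<partial>?P)"
    by simp
  also have "\<dots> \<le> (\<integral>\<^sup>+h. of_nat (card (ranked D r h)) \<partial>?P)"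
  proof (intro nn_integral_mono)
    fix h
    show "indicator {h. ranked D r h \<noteq> {}} h \<le> (of_nat (card (ranked D r h)) :: ennreal)"
    proof (cases "ranked D r h = {}")
      case False
      then have "1 \<le> card (ranked D r h)"
        using finite_ranked[of D r h] by (simp add: Suc_le_eq card_gt_0_iff)
      then have "(of_nat 1 :: ennreal) \<le> of_nat (card (ranked D r h))"
        by (simp only: of_nat_le_iff)
      then show ?thesis using False by (simp add: indicator_def)
    qed simp
  qed
  also have "\<dots> \<le> ennreal (real t * (real t * real M / real n) ^ r)"
    by (rule expectation_card_ranked[OF assms])
  finally show ?thesis
    by (simp add: measure_pmf.emeasure_eq_measure)
qed

section \<open>Steps of high rank forced by repeated offers or by large degrees\<close>

text \<open>As each vertex counts as reachable from itself, successive steps at \<open>x\<close>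
  have increasing ranks; the induction passes to the last earlier step at \<open>x\<close>, which
  has one predecessor fewer.\<close>

lemma ranked_of_repeated:
  assumes refl: "\<And>h x. x \<in> D h x"
    and "i < length h" "fst (h ! i) = x" "r \<le> card {j. j < i \<and> fst (h ! j) = x}"
  shows "i \<in> ranked D r h"
  using assms(2-)
proof (induction r arbitrary: i)
  case (Suc r)
  let ?J = "\<lambda>i. {j. j < i \<and> fst (h ! j) = x}"
  define j where "j = Max (?J i)"
  have ne: "?J i \<noteq> {}" using Suc.prems(3) by (metis Suc_n_not_le_n bot_nat_0.extremum card.empty le_trans)
  then have j: "j \<in> ?J i" unfolding j_def by (intro Max_in) auto
  have "?J i \<subseteq> insert j (?J j)"
  proof
    fix i' assume i': "i' \<in> ?J i"
    then have "i' \<le> j" unfolding j_def by (intro Max_ge) auto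
    then show "i' \<in> insert j (?J j)" using i' by auto
  qed
  then have "card (?J i) \<le> card (insert j (?J j))" by (intro card_mono) auto
  also have "\<dots> \<le> Suc (card (?J j))" by (rule card_insert_le_m1) auto
  finally have "r \<le> card (?J j)" using Suc.prems(3) by simp
  then have "j \<in> ranked D r h" using Suc j by auto
  then show ?case using j Suc.prems refl by auto
qed simp

text \<open>Here \<open>E s\<close> is the digraph formed inside \<open>X\<close> by the first
  \<open>s\<close> steps, and \<open>deg s\<close> counts those steps with multiplicity, a loop
  once. It suffices that \<open>D\<close> covers reachability inside \<open>X\<close>.\<close>

lemma ranked_of_min_degree:
  fixes h :: "('v \<times> 'v) list" and X :: "'v set"
  defines "E \<equiv> \<lambda>s. set (take s h) \<inter> X \<times> X"
    and "deg \<equiv> \<lambda>s w. card {i. i < s \<and> h ! i \<in> X \<times> X \<and> w \<in> {fst (h ! i), snd (h ! i)}}"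
  assumes D: "\<And>i x y. i < length h \<Longrightarrow> (x, y) \<in> (E i)\<^sup>* \<Longrightarrow> y \<in> D (take i h) x"
    and "X \<noteq> {}" and deg: "\<And>w. w \<in> X \<Longrightarrow> r < deg (length h) w"
  shows "ranked D r h \<noteq> {}"
proof -
  have E_mono: "(E i)\<^sup>* \<subseteq> (E s)\<^sup>*" if "i \<le> s" for i s
    unfolding E_def by (intro rtrancl_mono Int_mono set_take_subset_set_take that order_refl)
  have E_mem: "h ! i \<in> E s" if "i < s" "s \<le> length h" "h ! i \<in> X \<times> X" for i s
    using that nth_mem[of i "take s h"] unfolding E_def by simp
  have tail_reaches: "(fst (h ! i), w) \<in> (E s)\<^sup>*"
    if "i < s" "s \<le> length h" "h ! i \<in> X \<times> X" "w \<in> {fst (h ! i), snd (h ! i)}" for i s w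
    using E_mem[OF that(1-3)] that(4) by (cases "h ! i") auto
  \<comment> \<open>The claim ranges over all times \<open>s\<close> and vertices \<open>u\<close>,
    because the induction on \<open>r\<close> moves to an earlier time and another vertex.\<close>
  have main: "\<exists>w\<in>X. (w, u) \<in> (E s)\<^sup>* \<and> deg s w \<le> r"
    if "s \<le> length h" "u \<in> X"
      and "\<And>j. j \<in> ranked D r h \<Longrightarrow> j < s \<Longrightarrow> h ! j \<in> X \<times> X \<Longrightarrow> (fst (h ! j), u) \<notin> (E s)\<^sup>*"
    for r s u
    using that
  proof (induction r arbitrary: s u)
    case 0
    have "{i. i < s \<and> h ! i \<in> X \<times> X \<and> u \<in> {fst (h ! i), snd (h ! i)}} = {}"
    proof (rule equals0I, elim CollectE conjE)
      fix i assume i: "i < s" "h ! i \<in> X \<times> X" "u \<in> {fst (h ! i), snd (h ! i)}"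
      have "(fst (h ! i), u) \<in> (E s)\<^sup>*"
        by (rule tail_reaches[OF i(1) 0(1) i(2,3)])
      moreover have "i \<in> ranked D 0 h" using i(1) 0(1) by simp
      ultimately show False using 0(3)[OF _ i(1,2)] by (simp only: not_True_eq_False)
    qed
    then have "deg s u = 0" by (simp only: deg_def card.empty)
    then show ?case using 0(2) by auto
  next
    case (Suc r)
    define J where "J = {j. j < s \<and> h ! j \<in> X \<times> X \<and> (fst (h ! j), u) \<in> (E s)\<^sup>*}"
    \<comment> \<open>The tail of a step reaches both its ends, so a step that meets an ancestor of
      \<open>u\<close> also starts at one.\<close>
    have touch: "i \<in> J" if "i < s" "h ! i \<in> X \<times> X" "w \<in> {fst (h ! i), snd (h ! i)}" "(w, u) \<in> (E s)\<^sup>*"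
      for i w
    proof -
      have "(fst (h ! i), w) \<in> (E s)\<^sup>*"
        using tail_reaches[OF that(1) Suc.prems(1) that(2,3)] .
      then show ?thesis using that unfolding J_def by (auto intro: rtrancl_trans)
    qed
    show ?case
    proof (cases "J = {}")
      case True
      then have "{i. i < s \<and> h ! i \<in> X \<times> X \<and> u \<in> {fst (h ! i), snd (h ! i)}} = {}"
        using touch[OF _ _ _ rtrancl.rtrancl_refl] by (intro equals0I, elim CollectE conjE) simp
      then have "deg s u = 0" by (simp only: deg_def card.empty)
      then show ?thesis using Suc.prems(2) by auto
    next
      case False
      have finJ: "finite J" unfolding J_def by auto
      define j where "j = Max J"
      have "j \<in> J" unfolding j_def using finJ False by (rule Max_in)
      then have j: "j < s" "h ! j \<in> X \<times> X" "(fst (h ! j), u) \<in> (E s)\<^sup>*" unfolding J_def by auto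
      have jmax: "i \<le> j" if "i \<in> J" for i unfolding j_def using finJ that by (rule Max_ge)
      \<comment> \<open>Since \<open>j\<close> has too small a rank, no earlier step in
        \<open>ranked D r h\<close> reaches its tail, which is the premise of the induction
        hypothesis at time \<open>j\<close>.\<close>
      have "j \<notin> ranked D (Suc r) h" using Suc.prems(3)[of j] j by blast
      then have noj: "fst (h ! j) \<notin> D (take j h) (fst (h ! i))" if "i \<in> ranked D r h" "i < j" for i
        using that j Suc.prems(1) by auto
      have "\<exists>w\<in>X. (w, fst (h ! j)) \<in> (E j)\<^sup>* \<and> deg j w \<le> r"
      proof (rule Suc.IH)
        show "(fst (h ! i), fst (h ! j)) \<notin> (E j)\<^sup>*"
          if "i \<in> ranked D r h" "i < j" "h ! i \<in> X \<times> X" for i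
          using noj[OF that(1,2)] D[of j] j Suc.prems(1) by auto
      qed (use j Suc.prems(1) in auto)
      then obtain w where w: "w \<in> X" "(w, fst (h ! j)) \<in> (E j)\<^sup>*" "deg j w \<le> r" by blast
      have wu: "(w, u) \<in> (E s)\<^sup>*"
        using w(2) E_mono[of j s] j by (meson less_imp_le rtrancl_trans subsetD)
      \<comment> \<open>All steps meeting the ancestor \<open>w\<close> of \<open>u\<close> lie in
        \<open>J\<close>, hence come no later than its maximum \<open>j\<close>; after time
        \<open>j\<close> the degree of \<open>w\<close> rises by at most one.\<close>
      have "{i. i < s \<and> h ! i \<in> X \<times> X \<and> w \<in> {fst (h ! i), snd (h ! i)}} \<subseteq>
            insert j {i. i < j \<and> h ! i \<in> X \<times> X \<and> w \<in> {fst (h ! i), snd (h ! i)}}"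
      proof
        fix i assume i: "i \<in> {i. i < s \<and> h ! i \<in> X \<times> X \<and> w \<in> {fst (h ! i), snd (h ! i)}}"
        then have "i \<le> j" by (elim CollectE conjE) (rule jmax[OF touch[OF _ _ _ wu]])
        then show "i \<in> insert j {i. i < j \<and> h ! i \<in> X \<times> X \<and> w \<in> {fst (h ! i), snd (h ! i)}}"
          using i by auto
      qed
      then have "deg s w \<le> card (insert j {i. i < j \<and> h ! i \<in> X \<times> X \<and> w \<in> {fst (h ! i), snd (h ! i)}})"
        unfolding deg_def by (intro card_mono) auto
      also have "\<dots> \<le> Suc (deg j w)"
        unfolding deg_def by (rule card_insert_le_m1) auto
      finally show ?thesis using w wu by force
    qed
  qed
  show ?thesis
  proof
    assume "ranked D r h = {}"
    moreover obtain u where "u \<in> X" using \<open>X \<noteq> {}\<close> by blast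
    ultimately obtain w where "w \<in> X" "deg (length h) w \<le> r"
      using main[of "length h" u r] by auto
    then show False using deg[of w] by simp
  qed
qed

section \<open>Reachability along paths of bounded length\<close>

lemma relpow_mono:
  fixes R R' :: "('v \<times> 'v) set"
  shows "R \<subseteq> R' \<Longrightarrow> R ^^ m \<subseteq> R' ^^ m"
  by (induction m) auto

lemma finite_relpow_Image:
  fixes R :: "('v \<times> 'v) set"
  shows "finite R \<Longrightarrow> finite ((R ^^ m) `` {x})"
  by (induction m) (auto simp: relcomp_Image)

lemma card_relpow_Image_le:
  fixes R :: "('v \<times> 'v) set"
  assumes "finite R" "\<And>y. card (R `` {y}) \<le> d"
  shows "card ((R ^^ m) `` {x}) \<le> d ^ m"
proof (induction m)
  case (Suc m)
  have "(R ^^ Suc m) `` {x} = (\<Union>y\<in>(R ^^ m) `` {x}. R `` {y})"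
    by auto
  then have "card ((R ^^ Suc m) `` {x}) \<le> (\<Sum>y\<in>(R ^^ m) `` {x}. card (R `` {y}))"
    by (simp only: card_UN_le[OF finite_relpow_Image[OF assms(1)]])
  also have "\<dots> \<le> card ((R ^^ m) `` {x}) * d"
    using sum_bounded_above[of "(R ^^ m) `` {x}" "\<lambda>y. card (R `` {y})" d] assms(2) by simp
  also have "\<dots> \<le> d ^ Suc m" using Suc by simp
  finally show ?case .
qed simp

text \<open>The cut-off to \<open>{x}\<close> makes the size bound unconditional, as the first-moment estimate needs;
  it is not triggered as long as all out-degrees are at most \<open>d\<close>.\<close>

definition near_descendants :: "nat \<Rightarrow> nat \<Rightarrow> ('v \<times> 'v) list \<Rightarrow> 'v \<Rightarrow> 'v set" where
  "near_descendants d k h x =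
     (let B = \<Union>m\<le>k. (set h ^^ m) `` {x} in if card B \<le> (\<Sum>m\<le>k. d ^ m) then B else {x})"

lemma finite_near_descendants: "finite (near_descendants d k h x)"
  by (simp add: near_descendants_def Let_def finite_relpow_Image)

lemma self_in_near_descendants: "x \<in> near_descendants d k h x"
  by (auto simp: near_descendants_def Let_def intro!: bexI[of _ 0])

lemma card_near_descendants: "card (near_descendants d k h x) \<le> (\<Sum>m\<le>k. d ^ m)"
proof -
  \<comment> \<open>The summand \<open>d ^ 0 = 1\<close> leaves room for the singleton of the
    cut-off.\<close>
  have "d ^ 0 \<le> (\<Sum>m\<le>k. d ^ m)" by (rule member_le_sum) auto
  then show ?thesis by (auto simp: near_descendants_def Let_def)
qed

lemma near_descendants_eq:
  assumes "\<And>y. card (set h `` {y}) \<le> d"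
  shows "near_descendants d k h x = (\<Union>m\<le>k. (set h ^^ m) `` {x})"
proof -
  have "card (\<Union>m\<le>k. (set h ^^ m) `` {x}) \<le> (\<Sum>m\<le>k. card ((set h ^^ m) `` {x}))"
    by (rule card_UN_le) simp
  also have "\<dots> \<le> (\<Sum>m\<le>k. d ^ m)"
    by (intro sum_mono card_relpow_Image_le assms) simp
  finally show ?thesis by (simp add: near_descendants_def)
qed

text \<open>Reachability inside \<open>X\<close> is witnessed by a path with at most as many steps
  as there are pairs in \<open>X \<times> X\<close>, so the radius \<open>k\<close> is large enough.
  Either some vertex is offered often, or all out-degrees are small and the cut-off stays
  inactive.\<close>

lemma ranked_near_descendants_nonempty:
  fixes h :: "('v \<times> 'v) list"
  assumes X: "finite X" "X \<noteq> {}" "card X * card X \<le> k"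
    and deg: "\<And>w. w \<in> X \<Longrightarrow>
      r < card {i. i < length h \<and> h ! i \<in> X \<times> X \<and> w \<in> {fst (h ! i), snd (h ! i)}}"
  shows "ranked (near_descendants (Suc r) k) r h \<noteq> {}"
proof (cases "\<exists>i<length h. r \<le> card {j. j < i \<and> fst (h ! j) = fst (h ! i)}")
  case True
  \<comment> \<open>A vertex offered more than \<open>r\<close> times is reached by itself, so its steps have increasing ranks.\<close>
  then obtain i where i: "i < length h" "r \<le> card {j. j < i \<and> fst (h ! j) = fst (h ! i)}"
    by blast
  have "i \<in> ranked (near_descendants (Suc r) k) r h"
    by (rule ranked_of_repeated[OF self_in_near_descendants i(1) refl i(2)])
  then show ?thesis by auto
next
  case False
  \<comment> \<open>Every out-neighbour of \<open>y\<close> comes from a step at \<open>y\<close>,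
    and the last such step has fewer than \<open>r\<close> predecessors at \<open>y\<close>.\<close>
  have out: "card (set (take s h) `` {y}) \<le> Suc r" if "s \<le> length h" for s y
  proof -
    let ?I = "{j. j < s \<and> fst (h ! j) = y}"
    have "card ?I \<le> Suc r"
    proof (cases "?I = {}")
      case nonempty: False
      define i where "i = Max ?I"
      have i: "i \<in> ?I" unfolding i_def using nonempty by (intro Max_in) auto
      have "?I \<subseteq> insert i {j. j < i \<and> fst (h ! j) = fst (h ! i)}"
      proof
        fix j assume j: "j \<in> ?I"
        then have "j \<le> i" unfolding i_def by (intro Max_ge) auto
        then have "j = i \<or> j < i" by linarith
        moreover have "fst (h ! j) = fst (h ! i)" using i j by simp
        ultimately show "j \<in> insert i {j. j < i \<and> fst (h ! j) = fst (h ! i)}" by blast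
      qed
      then have "card ?I \<le> card (insert i {j. j < i \<and> fst (h ! j) = fst (h ! i)})"
        by (intro card_mono) auto
      also have "\<dots> \<le> Suc (card {j. j < i \<and> fst (h ! j) = fst (h ! i)})"
        by (rule card_insert_le_m1) auto
      also have "\<dots> \<le> Suc r"
      proof -
        have "i < length h" using i that by simp
        then show ?thesis using False by (meson Suc_le_mono nat_le_linear)
      qed
      finally show ?thesis .
    qed (simp only: card.empty)
    moreover have "card (set (take s h) `` {y}) \<le> card ?I"
      by (rule surj_card_le[where f = "\<lambda>j. snd (h ! j)"]) (force simp: in_set_conv_nth)+
    ultimately show ?thesis by linarith
  qed
  show ?thesis
  proof (rule ranked_of_min_degree[OF _ X(2) deg])
    fix i x y
    let ?E = "set (take i h) \<inter> X \<times> X"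
    assume i: "i < length h" and "(x, y) \<in> ?E\<^sup>*"
    then obtain m where m: "m \<le> card ?E" "(x, y) \<in> ?E ^^ m"
      by (auto simp: rtrancl_finite_eq_relpow)
    have "card ?E \<le> card (X \<times> X)" using X(1) by (intro card_mono) auto
    then have "m \<le> k" using m(1) X(3) by (simp add: card_cartesian_product)
    moreover have "(x, y) \<in> set (take i h) ^^ m"
      using m(2) relpow_mono[of ?E "set (take i h)" m] by blast
    ultimately show "y \<in> near_descendants (Suc r) k (take i h) x"
      using i out[of i] by (subst near_descendants_eq) auto
  qed
qed

section \<open>From copies of \<open>G\<close> to the limit\<close>

text \<open>Minimality of the degeneracy yields a subgraph \<open>L\<close> of \<open>G\<close> with
  minimum degree above \<open>r\<close>; \<open>X\<close> is its vertex set pulled back to the copy.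
  Distinct edges of \<open>L\<close> come from distinct steps inside \<open>X\<close>.\<close>

lemma dense_vertex_set_of_contains_copy:
  assumes G: "finite_simple_graph G" and d: "r < degeneracy G"
    and copy: "contains_copy (history_graph n h) G"
  obtains X where "finite X" "X \<noteq> {}" "card X \<le> card (verts G)"
    "\<And>w. w \<in> X \<Longrightarrow> r < card {i. i < length h \<and> h ! i \<in> X \<times> X \<and> w \<in> {fst (h ! i), snd (h ! i)}}"
proof -
  have "\<not> degenerate r G" using d not_less_Least unfolding degeneracy_def by blast
  then obtain L where L: "subgraph L G" "verts L \<noteq> {}" "r < min_degree L"
    by (auto simp: degenerate_def not_le)
  obtain K f where K: "subgraph K (history_graph n h)"
    and f: "bij_betw f (verts K) (verts G)" "edges G = image_mset (\<lambda>e. f ` e) (edges K)"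
    using copy by (auto simp: contains_copy_def isomorphic_def)
  have finG: "finite (verts G)" using G by (simp add: finite_simple_graph_def)
  have finK: "finite (verts K)" using finG f(1) bij_betw_finite by blast
  have LG: "verts L \<subseteq> verts G" "edges L \<subseteq># edges G" "wf_mgraph L"
    using L(1) by (auto simp: subgraph_def)
  define X where "X = {x \<in> verts K. f x \<in> verts L}"
  have XK: "X \<subseteq> verts K" by (auto simp: X_def)
  show ?thesis
  proof
    show "finite X" using XK finK finite_subset by blast
    show "X \<noteq> {}" using L(2) LG(1) f(1) by (force simp: X_def bij_betw_def)
    show "card X \<le> card (verts G)"
      using bij_betw_same_card[OF f(1)] card_mono[OF finK XK] by simp
    fix w assume w: "w \<in> X"
    let ?A = "{#e \<in># edges L. f w \<in> e#}"
    let ?I = "{i. i < length h \<and> h ! i \<in> X \<times> X \<and> w \<in> {fst (h ! i), snd (h ! i)}}"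
    have "min_degree L \<le> degree L (f w)"
      unfolding min_degree_def using w finite_subset[OF LG(1) finG] by (intro Min_le) (auto simp: X_def)
    \<comment> \<open>Simplicity of \<open>G\<close> removes the loop term here and multiplicities
      below, so the degree counts distinct edges.\<close>
    also have "count (edges L) {f w} = 0"
    proof (rule ccontr)
      assume "count (edges L) {f w} \<noteq> 0"
      then have "{f w} \<in># edges G" using mset_subset_eqD[OF LG(2)] by (auto simp: count_eq_zero_iff)
      then show False using G by (auto simp: finite_simple_graph_def)
    qed
    then have "degree L (f w) = size ?A" by (simp add: degree_def)
    also have "size ?A = card (set_mset ?A)"
    proof -
      have "count ?A e = 1" if "e \<in># ?A" for e
      proof -
        have "count (edges L) e \<le> count (edges G) e" using LG(2) by (rule mset_subset_eq_count)
        also have "\<dots> \<le> 1" using G by (simp add: finite_simple_graph_def)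
        moreover have "count (edges L) e > 0" using that by simp
        moreover have "count ?A e = count (edges L) e" using that by simp
        ultimately show ?thesis by linarith
      qed
      then show ?thesis by (simp add: size_multiset_overloaded_eq del: set_mset_filter)
    qed
    also have "\<dots> \<le> card ((\<lambda>i. f ` {fst (h ! i), snd (h ! i)}) ` ?I)"
    proof (rule card_mono)
      show "set_mset ?A \<subseteq> (\<lambda>i. f ` {fst (h ! i), snd (h ! i)}) ` ?I"
      proof
        fix e assume "e \<in># ?A"
        then have e: "e \<in># edges L" "f w \<in> e" by auto
        then have "e \<in># edges G" using mset_subset_eqD[OF LG(2)] by blast
        then obtain e' where e': "e' \<in># edges K" "e = f ` e'" using f(2) by auto
        have e'K: "e' \<subseteq> verts K" using K e'(1) by (auto simp: subgraph_def wf_mgraph_def)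
        have "e \<subseteq> verts L" using e(1) LG(3) by (auto simp: wf_mgraph_def)
        then have e'X: "e' \<subseteq> X" using e'K e'(2) by (auto simp: X_def)
        have we': "w \<in> e'"
          using e(2) e'(2) e'K w XK f(1) by (auto simp: bij_betw_def dest: inj_onD)
        have "e' \<in># edges (history_graph n h)"
          using K e'(1) by (auto simp: subgraph_def dest: mset_subset_eqD)
        then obtain i where "i < length h" "e' = {fst (h ! i), snd (h ! i)}"
          by (auto simp: history_graph_def in_set_conv_nth case_prod_unfold)
        then show "e \<in> (\<lambda>i. f ` {fst (h ! i), snd (h ! i)}) ` ?I"
          using e'X we' e'(2) by (intro image_eqI[of _ _ i]) (auto simp: mem_Times_iff)
      qed
    qed auto
    also have "\<dots> \<le> card ?I" by (rule card_image_le) auto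
    finally show "r < card ?I" using L(3) by simp
  qed
qed

text \<open>A copy forces a step in \<open>ranked ?D r h\<close>. The radius \<open>?k\<close>
  serves every \<open>X\<close> that can arise, as \<open>card X \<le> card (verts G)\<close>, and
  \<open>M\<close> bounds the number of near descendants.\<close>

lemma prob_contains_copy_le:
  assumes G: "finite_simple_graph G" and d: "degeneracy G = Suc r" and n: "n > 0"
  defines "M \<equiv> \<Sum>m\<le>card (verts G) * card (verts G). Suc r ^ m"
  shows "measure_pmf.prob (semi_random_graph S n t) {H. contains_copy H G}
           \<le> real t * (real t * real M / real n) ^ r"
proof -
  let ?k = "card (verts G) * card (verts G)"
  let ?D = "near_descendants (Suc r) ?k :: history \<Rightarrow> nat \<Rightarrow> nat set"
  have "measure_pmf.prob (semi_random_graph S n t) {H. contains_copy H G} =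
        measure_pmf.prob (semi_random_process S n t) {h. contains_copy (history_graph n h) G}"
    by (simp add: semi_random_graph_def vimage_def)
  also have "\<dots> \<le> measure_pmf.prob (semi_random_process S n t) {h. ranked ?D r h \<noteq> {}}"
  proof (rule measure_pmf.finite_measure_mono)
    show "{h. contains_copy (history_graph n h) G} \<subseteq> {h. ranked ?D r h \<noteq> {}}"
    proof safe
      fix h assume copy: "contains_copy (history_graph n h) G" and empty: "ranked ?D r h = {}"
      obtain X where X: "finite X" "X \<noteq> {}" "card X \<le> card (verts G)"
        "\<And>w. w \<in> X \<Longrightarrow> r < card {i. i < length h \<and> h ! i \<in> X \<times> X \<and> w \<in> {fst (h ! i), snd (h ! i)}}"
        using dense_vertex_set_of_contains_copy[OF G _ copy, of r] d by auto
      then show False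
        using ranked_near_descendants_nonempty[of X ?k r h] mult_le_mono[OF X(3) X(3)] empty by blast
    qed
  qed simp
  also have "\<dots> \<le> real t * (real t * real M / real n) ^ r"
    unfolding M_def
    by (rule prob_ranked_nonempty[OF n finite_near_descendants card_near_descendants])
  finally show ?thesis .
qed

theorem theorem1p2:
  fixes G :: "'a mgraph" and d :: nat and \<omega> :: "nat \<Rightarrow> real" and S :: strategy
  assumes "finite_simple_graph G"
    and "degeneracy G = d"
    and "d \<ge> 2"
    and "filterlim \<omega> at_top sequentially"
    and "valid_strategy S"
  shows "(\<lambda>n. measure_pmf.prob
            (semi_random_graph S n (nat \<lfloor>real n powr ((real d - 1) / real d) / \<omega> n\<rfloor>))
            {H. contains_copy H G}) \<longlonglongrightarrow> 0"
proof -
  obtain r where r: "d = Suc r" using assms(3) by (cases d) auto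
  define M where "M = (\<Sum>m\<le>card (verts G) * card (verts G). Suc r ^ m)"
  define t where "t = (\<lambda>n. nat \<lfloor>real n powr ((real d - 1) / real d) / \<omega> n\<rfloor>)"
  \<comment> \<open>The \<open>d\<close>-th power of \<open>t n\<close> is at most
    \<open>n ^ r / \<omega> n ^ d\<close>, so the powers of \<open>n\<close> cancel;
    \<open>M\<close> depends on \<open>G\<close> alone.\<close>
  have bound: "measure_pmf.prob (semi_random_graph S n (t n)) {H. contains_copy H G}
      \<le> real M ^ r * inverse (\<omega> n) ^ d" if n: "n > 0" and w: "\<omega> n > 0" for n
  proof -
    have t: "real (t n) \<le> real n powr ((real d - 1) / real d) / \<omega> n"
      unfolding t_def using w by (simp add: of_nat_floor)
    have "(real n powr ((real d - 1) / real d)) ^ d = real n powr ((real d - 1) / real d * real d)"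
      using n by (simp only: powr_powr powr_realpow[symmetric] powr_gt_zero)
    also have "\<dots> = real n powr real r" using r by simp
    also have "\<dots> = real n ^ r" using n by (simp add: powr_realpow)
    finally have pw: "(real n powr ((real d - 1) / real d)) ^ d = real n ^ r" .
    have "measure_pmf.prob (semi_random_graph S n (t n)) {H. contains_copy H G}
        \<le> real (t n) * (real (t n) * real M / real n) ^ r"
      unfolding M_def using prob_contains_copy_le[OF assms(1) _ n] assms(2) r by blast
    also have "\<dots> = real (t n) ^ d * real M ^ r / real n ^ r"
      by (simp add: r power_divide power_mult_distrib)
    also have "\<dots> \<le> (real n powr ((real d - 1) / real d) / \<omega> n) ^ d * real M ^ r / real n ^ r"
      by (intro divide_right_mono mult_right_mono power_mono t) auto
    also have "\<dots> = real M ^ r * inverse (\<omega> n) ^ d"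
      using n by (simp add: power_divide pw field_simps)
    finally show ?thesis .
  qed
  have "(\<lambda>n. inverse (\<omega> n)) \<longlonglongrightarrow> 0"
    using assms(4) by (rule tendsto_inverse_0_at_top)
  then have "(\<lambda>n. real M ^ r * inverse (\<omega> n) ^ d) \<longlonglongrightarrow> real M ^ r * 0 ^ d"
    by (intro tendsto_intros)
  then have lim: "(\<lambda>n. real M ^ r * inverse (\<omega> n) ^ d) \<longlonglongrightarrow> 0" by (simp add: r)
  \<comment> \<open>Both \<open>n\<close> and \<open>\<omega> n\<close> are positive for all large
    \<open>n\<close>.\<close>
  have ev: "\<forall>\<^sub>F n in sequentially. measure_pmf.prob (semi_random_graph S n (t n)) {H. contains_copy H G}
      \<le> real M ^ r * inverse (\<omega> n) ^ d"
    using eventually_gt_at_top[of 0] filterlim_at_top_dense[THEN iffD1, OF assms(4), rule_format, of 0]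
    by eventually_elim (rule bound)
  have "(\<lambda>n. measure_pmf.prob (semi_random_graph S n (t n)) {H. contains_copy H G}) \<longlonglongrightarrow> 0"
    by (rule tendsto_sandwich[OF _ ev tendsto_const lim]) simp
  then show ?thesis by (simp only: t_def)
qed

end
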